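(* Let $B$ be a symmetric Hadamard matrix and $U_B$ its Hadamard graphon. Then $$\mathrm{I}_{\mathcal{A}}(\{U_B\})=\{g\in\mathcal{A}: P(B,g)=0\}.$$
   Context: A kernel is a bounded symmetric measurable function $W:[0,1]^2\to\mathbb{R}$; a graphon is a kernel with $0\le W\le1$. For a kernel $W$ and a finite loopless multigraph $F=(V,E)$, the homomorphism density is $t(F,W)=\int_{[0,1]^V}\prod_{ij\in E}W(x_i,x_j)\prod_{i\in V}dx_i$ (product over edges with multiplicity). $\mathcal{A}$ is the complex vector space of quantum graphs, i.e. finite formal $\mathbb{C}$-linear combinations of unlabeled finite loopless multigraphs (basis: isomorphism classes). The density extends linearly: $t(\sum_i\alpha_iF_i,W)=\sum_i\alpha_i t(F_i,W)$. For a set $Y$ of kernels, $\mathrm{I}_{\mathcal{A}}(Y)=\{g\in\mathcal{A}: t(g,W)=0\text{ for every }W\in Y\}$. A Hadamard matrix of order $n$ is an $n\times n$ matrix $H$ with entries in $\{\pm1\}$ such that $HH^T=nI_n$. For a symmetric $n\times n$ matrix $P=(p_{ij})$, the equal-step kernel $W_P$ is given by $W_P(x,y)=p_{ij}$ for $x\in T_i$, $y\in T_j$, where $T_i=[\frac{i-1}{n},\frac{i}{n})$ for $1\le i<n$ and $T_n=[\frac{n-1}{n},1]$. For a symmetric Hadamard matrix $B$, the Hadamard graphon associated to $B$ is $U_B=\frac{W_B+1}{2}$. For a symmetric $n\times n$ Hadamard matrix $B=(b_{ij})$ and a finite loopless multigraph $F$, $$P(B,F)=\frac{1}{n^{|V(F)|}}\#\{\varphi:V(F)\to[n]: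 b_{\varphi(u)\varphi(v)}=1\text{ for every }uv\in E(F)\},$$ and for a quantum graph $g=\sum_i\alpha_iF_i$, $P(B,g)=\sum_i\alpha_iP(B,F_i)$. *)

theory Defs
  imports
    "HOL-Probability.Infinite_Product_Measure"
    "HOL-Library.Poly_Mapping"
    "Jordan_Normal_Form.Matrix"
begin

section \<open>Finite loopless multigraphs and quantum graphs\<close>

text \<open>
  Multigraphs are taken with vertices in \<open>nat\<close>, which loses no isomorphism class. An edge is a
  two-element set of vertices, and its number of occurrences in the multiset is its multiplicity.
  The graph without vertices is included.
\<close>

typedef multigraph =
  "{(V :: nat set, E :: nat set multiset). finite V \<and> (\<forall>e\<in>#E. e \<subseteq> V \<and> card e = 2)}"
  by (rule exI[of _ "({}, {#})"]) simp

setup_lifting type_definition_multigraph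

lift_definition verts :: "multigraph \<Rightarrow> nat set" is fst .
lift_definition edges :: "multigraph \<Rightarrow> nat set multiset" is snd .

lemma finite_verts [simp]: "finite (verts F)"
  by transfer (simp add: case_prod_unfold)

lemma edges_subset: "e \<in># edges F \<Longrightarrow> e \<subseteq> verts F"
  by transfer (simp add: case_prod_unfold)

lemma edges_card: "e \<in># edges F \<Longrightarrow> card e = 2"
  by transfer (simp add: case_prod_unfold)

definition multigraph_iso :: "multigraph \<Rightarrow> multigraph \<Rightarrow> bool" where
  "multigraph_iso F G \<longleftrightarrow>
     (\<exists>f. bij_betw f (verts F) (verts G) \<and> edges G = image_mset (image f) (edges F))"

lemma equivp_multigraph_iso: "equivp multigraph_iso"
proof (rule equivpI)
  show "reflp multigraph_iso"
    by (auto simp: reflp_def multigraph_iso_def intro!: exI[of _ id])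
  show "symp multigraph_iso"
  proof (rule sympI)
    fix F G assume "multigraph_iso F G"
    then obtain f where f: "bij_betw f (verts F) (verts G)"
      and E: "edges G = image_mset (image f) (edges F)"
      by (auto simp: multigraph_iso_def)
    let ?g = "inv_into (verts F) f"
    have "image_mset (image ?g) (edges G) = image_mset (\<lambda>e. ?g ` f ` e) (edges F)"
      by (simp add: E multiset.map_comp o_def)
    also have "\<dots> = image_mset (\<lambda>e. e) (edges F)"
    proof (rule image_mset_cong)
      fix e assume "e \<in># edges F"
      then show "?g ` f ` e = e"
        using f edges_subset by (metis bij_betw_imp_inj_on inv_into_image_cancel)
    qed
    finally show "multigraph_iso G F"
      unfolding multigraph_iso_def using bij_betw_inv_into[OF f] by auto
  qed
  show "transp multigraph_iso"
  proof (rule transpI)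
    fix F G H assume "multigraph_iso F G" "multigraph_iso G H"
    then obtain f g where "bij_betw f (verts F) (verts G)" "bij_betw g (verts G) (verts H)"
      "edges G = image_mset (image f) (edges F)" "edges H = image_mset (image g) (edges G)"
      by (auto simp: multigraph_iso_def)
    then show "multigraph_iso F H"
      unfolding multigraph_iso_def
      by (intro exI[of _ "g \<circ> f"]) (auto dest: bij_betw_trans simp: multiset.map_comp o_def image_image)
  qed
qed

quotient_type unlabeled_graph = multigraph / multigraph_iso
  by (rule equivp_multigraph_iso)

type_synonym quantum_graph = "unlabeled_graph \<Rightarrow>\<^sub>0 complex"

text \<open>Isomorphism-invariant parameters of multigraphs are extended linearly; their value on an
  isomorphism class is read off at its representative.\<close>

definition linear_extension :: "(multigraph \<Rightarrow> real) \<Rightarrow> quantum_graph \<Rightarrow> complex" where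
  "linear_extension p g =
     (\<Sum>F\<in>Poly_Mapping.keys g. Poly_Mapping.lookup g F * complex_of_real (p (rep_unlabeled_graph F)))"

lemma linear_extension_single:
  assumes "\<And>F G. multigraph_iso F G \<Longrightarrow> p F = p G"
  shows "linear_extension p (Poly_Mapping.single (abs_unlabeled_graph F) a) = a * complex_of_real (p F)"
proof -
  have "multigraph_iso (rep_unlabeled_graph (abs_unlabeled_graph F)) F"
    using Quotient3_rep_abs[OF Quotient3_unlabeled_graph] equivp_multigraph_iso
    by (metis equivp_reflp)
  then show ?thesis
    using assms by (auto simp: linear_extension_def)
qed

section \<open>Kernels and homomorphism densities\<close>

abbreviation unit_interval :: "real measure" where
  "unit_interval \<equiv> restrict_space lborel {0..1}"

text \<open>Only the values on the unit square matter.\<close>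

definition kernel :: "(real \<Rightarrow> real \<Rightarrow> real) \<Rightarrow> bool" where
  "kernel W \<longleftrightarrow>
     case_prod W \<in> borel_measurable (unit_interval \<Otimes>\<^sub>M unit_interval) \<and>
     bounded (case_prod W ` ({0..1} \<times> {0..1})) \<and>
     (\<forall>x\<in>{0..1}. \<forall>y\<in>{0..1}. W x y = W y x)"

definition graphon :: "(real \<Rightarrow> real \<Rightarrow> real) \<Rightarrow> bool" where
  "graphon W \<longleftrightarrow> kernel W \<and> (\<forall>x\<in>{0..1}. \<forall>y\<in>{0..1}. 0 \<le> W x y \<and> W x y \<le> 1)"

text \<open>The end points of an edge \<open>e\<close> are \<open>Min e\<close> and \<open>Max e\<close>; their order is irrelevant for a kernel.\<close>

definition hom_density :: "multigraph \<Rightarrow> (real \<Rightarrow> real \<Rightarrow> real) \<Rightarrow> real" where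
  "hom_density F W =
     (\<integral>x. (\<Prod>e\<in>#edges F. W (x (Min e)) (x (Max e))) \<partial>(\<Pi>\<^sub>M i\<in>verts F. unit_interval))"

definition quantum_density :: "quantum_graph \<Rightarrow> (real \<Rightarrow> real \<Rightarrow> real) \<Rightarrow> complex" where
  "quantum_density g W = linear_extension (\<lambda>F. hom_density F W) g"

definition annihilator :: "(real \<Rightarrow> real \<Rightarrow> real) set \<Rightarrow> quantum_graph set" where
  "annihilator Y = {g. \<forall>W\<in>Y. quantum_density g W = 0}"

lemma edge_ends:
  assumes "e \<in># edges F"
  shows "e = {Min e, Max e}" "Min e \<in> verts F" "Max e \<in> verts F"
proof -
  obtain u v where e: "e = {u, v}" "u \<noteq> v"
    using edges_card[OF assms] by (auto simp: card_2_iff)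
  then show *: "e = {Min e, Max e}"
    by (auto simp: min_def max_def)
  show "Min e \<in> verts F" "Max e \<in> verts F"
    using edges_subset[OF assms] * by blast+
qed

lemma space_unit_PiM:
  "x \<in> space (\<Pi>\<^sub>M i\<in>I. unit_interval) \<Longrightarrow> i \<in> I \<Longrightarrow> x i \<in> {0..1}"
  by (auto simp: space_PiM space_restrict_space PiE_def Pi_def)

lemma prob_space_unit_interval: "prob_space unit_interval"
  by (rule prob_spaceI) (simp add: emeasure_restrict_space space_restrict_space)

lemma measurable_edge_prod:
  assumes "kernel W" "\<And>e. e \<in># E \<Longrightarrow> Min e \<in> V \<and> Max e \<in> V"
  shows "(\<lambda>x. \<Prod>e\<in>#E. W (x (Min e)) (x (Max e))) \<in> borel_measurable (\<Pi>\<^sub>M i\<in>V. unit_interval)"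
  using assms(2)
proof (induction E)
  case empty
  then show ?case by simp
next
  case (add e E)
  have "(\<lambda>x. case_prod W (x (Min e), x (Max e))) \<in> borel_measurable (\<Pi>\<^sub>M i\<in>V. unit_interval)"
  proof (rule measurable_compose[where N = "unit_interval \<Otimes>\<^sub>M unit_interval"])
    show "(\<lambda>x. (x (Min e), x (Max e))) \<in> (\<Pi>\<^sub>M i\<in>V. unit_interval) \<rightarrow>\<^sub>M unit_interval \<Otimes>\<^sub>M unit_interval"
      using add.prems[of e] by (intro measurable_Pair measurable_component_singleton) auto
    show "case_prod W \<in> borel_measurable (unit_interval \<Otimes>\<^sub>M unit_interval)"
      using assms(1) by (simp add: kernel_def)
  qed
  then show ?case
    using add by (auto intro!: borel_measurable_times)
qed

lemma hom_density_iso: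
  assumes W: "kernel W" and FG: "multigraph_iso F G"
  shows "hom_density F W = hom_density G W"
proof -
  obtain f where f: "bij_betw f (verts F) (verts G)"
    and E: "edges G = image_mset (image f) (edges F)"
    using FG by (auto simp: multigraph_iso_def)
  let ?h = "\<lambda>x. \<Prod>e\<in>#edges F. W (x (Min e)) (x (Max e))"
  let ?t = "\<lambda>x. \<lambda>n\<in>verts F. x (f n)"
  let ?F = "\<Pi>\<^sub>M i\<in>verts F. unit_interval" and ?G = "\<Pi>\<^sub>M i\<in>verts G. unit_interval"
  have inj: "inj_on f (verts F)" and maps: "f \<in> verts F \<rightarrow> verts G"
    using f by (auto simp: bij_betw_def)
  have D: "distr ?G ?F ?t = ?F"
    using distr_PiM_reindex[of "verts G" "\<lambda>_. unit_interval" f "verts F"] prob_space_unit_interval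
      inj maps by simp
  have meas: "?t \<in> ?G \<rightarrow>\<^sub>M ?F"
    using maps by (intro measurable_restrict measurable_component_singleton) auto
  have "hom_density F W = (\<integral>x. ?h x \<partial>distr ?G ?F ?t)"
    by (simp add: D hom_density_def)
  also have "\<dots> = (\<integral>x. ?h (?t x) \<partial>?G)"
    using edge_ends W by (intro integral_distr meas measurable_edge_prod) auto
  also have "\<dots> = (\<integral>x. (\<Prod>e\<in>#edges G. W (x (Min e)) (x (Max e))) \<partial>?G)"
  proof (rule Bochner_Integration.integral_cong[OF refl])
    fix x assume x: "x \<in> space ?G"
    have "W (?t x (Min e)) (?t x (Max e)) = W (x (Min (f ` e))) (x (Max (f ` e)))"
      if e: "e \<in># edges F" for e
    proof -
      have fe: "f ` e = {f (Min e), f (Max e)}"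
        using edge_ends(1)[OF e] by (metis image_empty image_insert)
      have in_G: "f (Min e) \<in> verts G" "f (Max e) \<in> verts G"
        using edge_ends[OF e] maps by auto
      have sym: "W (x (f (Min e))) (x (f (Max e))) = W (x (f (Max e))) (x (f (Min e)))"
        using W space_unit_PiM[OF x] in_G unfolding kernel_def by blast
      show ?thesis
        using edge_ends[OF e] sym unfolding fe by (auto simp: min_def max_def)
    qed
    then show "?h (?t x) = (\<Prod>e\<in>#edges G. W (x (Min e)) (x (Max e)))"
      by (auto simp: E multiset.map_comp o_def intro!: arg_cong[of _ _ prod_mset] image_mset_cong)
  qed
  finally show ?thesis
    by (simp add: hom_density_def)
qed

section \<open>Hadamard graphons\<close>

definition hadamard_mat :: "nat \<Rightarrow> real mat \<Rightarrow> bool" where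
  "hadamard_mat n H \<longleftrightarrow>
     H \<in> carrier_mat n n \<and> (\<forall>i<n. \<forall>j<n. H $$ (i, j) \<in> {1, - 1}) \<and>
     H * transpose_mat H = real n \<cdot>\<^sub>m 1\<^sub>m n"

text \<open>Matrix indices start at 0, hence so do the steps.\<close>

definition equal_step :: "nat \<Rightarrow> nat \<Rightarrow> real set" where
  "equal_step n i =
     (if Suc i = n then {real i / real n..1} else {real i / real n..<real (Suc i) / real n})"

definition step_kernel :: "real mat \<Rightarrow> real \<Rightarrow> real \<Rightarrow> real" where
  "step_kernel P x y =
     (\<Sum>i<dim_row P. \<Sum>j<dim_row P.
        P $$ (i, j) * indicator (equal_step (dim_row P) i) x * indicator (equal_step (dim_row P) j) y)"

definition hadamard_graphon :: "real mat \<Rightarrow> real \<Rightarrow> real \<Rightarrow> real" where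
  "hadamard_graphon B x y = (step_kernel B x y + 1) / 2"

text \<open>The labels of the vertex maps are \<open>0, \<dots>, n - 1\<close>.\<close>

definition hom_prob :: "real mat \<Rightarrow> multigraph \<Rightarrow> real" where
  "hom_prob B F =
     1 / real (dim_row B) ^ card (verts F) *
     real (card {\<phi> \<in> verts F \<rightarrow>\<^sub>E {..<dim_row B}.
        \<forall>u v. {u, v} \<in># edges F \<longrightarrow> B $$ (\<phi> u, \<phi> v) = 1})"

definition quantum_prob :: "real mat \<Rightarrow> quantum_graph \<Rightarrow> complex" where
  "quantum_prob B g = linear_extension (hom_prob B) g"

lemma equal_step_disjoint:
  assumes "x \<in> equal_step n i" "x \<in> equal_step n k" "i < n" "k < n"
  shows "i = k"
proof -
  have aux: False if "x \<in> equal_step n i" "x \<in> equal_step n k" "i < k" "k < n" for i k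
  proof -
    have "x < real (Suc i) / real n" "real k / real n \<le> x"
      using that by (auto simp: equal_step_def split: if_splits)
    moreover have "real (Suc i) / real n \<le> real k / real n"
      using that by (intro divide_right_mono) auto
    ultimately show False by linarith
  qed
  show ?thesis
    using aux[of i k] aux[of k i] assms by (meson linorder_neqE_nat)
qed

lemma equal_step_cover:
  assumes "0 < n" "x \<in> {0..1}"
  obtains i where "i < n" "x \<in> equal_step n i"
proof (cases "x = 1")
  case True
  then show ?thesis
    using assms by (intro that[of "n - 1"]) (auto simp: equal_step_def)
next
  case False
  define i where "i = nat \<lfloor>x * real n\<rfloor>"
  have i: "real i \<le> x * real n" "x * real n < real i + 1"
    using assms unfolding i_def by auto
  moreover have "x * real n < 1 * real n"
    using False assms by (intro mult_strict_right_mono) auto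
  ultimately have "i < n"
    by linarith
  moreover have "real i / real n \<le> x" "x < real (Suc i) / real n"
    using i assms by (auto simp: field_simps)
  ultimately show ?thesis
    using assms by (intro that[of i]) (auto simp: equal_step_def)
qed

lemma step_kernel_eq:
  assumes "i < dim_row P" "j < dim_row P"
    and "x \<in> equal_step (dim_row P) i" "y \<in> equal_step (dim_row P) j"
  shows "step_kernel P x y = P $$ (i, j)"
proof -
  let ?n = "dim_row P"
  have ind: "indicator (equal_step ?n k) z = (if k = l then 1 else 0 :: real)"
    if "z \<in> equal_step ?n l" "l < ?n" "k < ?n" for k l z
  proof (cases "k = l")
    case False
    then have "z \<notin> equal_step ?n k"
      using equal_step_disjoint[OF _ that(1) that(3) that(2)] by blast
    then show ?thesis
      using False by simp
  qed (use that in simp)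
  have "step_kernel P x y =
      (\<Sum>k<?n. \<Sum>l<?n. P $$ (k, l) * (if k = i then 1 else 0) * (if l = j then 1 else 0))"
    unfolding step_kernel_def
    using assms by (intro sum.cong refl) (simp add: ind)
  also have "\<dots> = (\<Sum>k<?n. if k = i then P $$ (k, j) else 0)"
    using assms by (intro sum.cong refl) (auto simp: if_distrib cong: if_cong)
  also have "\<dots> = P $$ (i, j)"
    using assms by simp
  finally show ?thesis .
qed

lemma measurable_step_kernel:
  "case_prod (step_kernel P) \<in> borel_measurable (unit_interval \<Otimes>\<^sub>M unit_interval)"
proof -
  have "indicator (equal_step m i) \<in> borel_measurable unit_interval" for m i
    by (intro measurable_restrict_space1) (auto simp: equal_step_def)
  then have [measurable]:
      "(\<lambda>p. indicator (equal_step m i) (fst p) :: real) \<in> borel_measurable (unit_interval \<Otimes>\<^sub>M unit_interval)"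
      "(\<lambda>p. indicator (equal_step m i) (snd p) :: real) \<in> borel_measurable (unit_interval \<Otimes>\<^sub>M unit_interval)"
    for m i
    using measurable_compose[OF measurable_fst] measurable_compose[OF measurable_snd] by blast+
  show ?thesis
    unfolding step_kernel_def case_prod_beta' by measurable
qed

lemma graphon_hadamard_graphon:
  assumes n: "0 < n" and B: "hadamard_mat n B" "transpose_mat B = B"
  shows "graphon (hadamard_graphon B)"
proof -
  have dim: "dim_row B = n" "dim_col B = n"
    and entry: "\<And>i j. i < n \<Longrightarrow> j < n \<Longrightarrow> B $$ (i, j) \<in> {1, - 1}"
    using B by (auto simp: hadamard_mat_def)
  have sym: "B $$ (i, j) = B $$ (j, i)" if "i < n" "j < n" for i j
    using that B(2) dim by (metis index_transpose_mat(1))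
  have *: "hadamard_graphon B x y = hadamard_graphon B y x \<and> hadamard_graphon B x y \<in> {0..1}"
    if xy: "x \<in> {0..1}" "y \<in> {0..1}" for x y
  proof -
    obtain i where i: "i < n" "x \<in> equal_step n i"
      using equal_step_cover[OF n xy(1)] .
    obtain j where j: "j < n" "y \<in> equal_step n j"
      using equal_step_cover[OF n xy(2)] .
    show ?thesis
      using i j sym[of i j] entry[of i j] step_kernel_eq[of i B j x y] step_kernel_eq[of j B i y x]
      by (auto simp: dim hadamard_graphon_def)
  qed
  have "case_prod (hadamard_graphon B) \<in> borel_measurable (unit_interval \<Otimes>\<^sub>M unit_interval)"
    using measurable_step_kernel[of B]
    unfolding hadamard_graphon_def case_prod_beta' by measurable
  moreover have "bounded (case_prod (hadamard_graphon B) ` ({0..1} \<times> {0..1}))"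
    using * by (intro bounded_subset[OF bounded_closed_interval[of 0 1]]) auto
  ultimately show ?thesis
    using * by (auto simp: graphon_def kernel_def)
qed

lemma hom_prob_iso:
  assumes FG: "multigraph_iso F G"
  shows "hom_prob B F = hom_prob B G"
proof -
  obtain f where f: "bij_betw f (verts F) (verts G)"
    and E: "edges G = image_mset (image f) (edges F)"
    using FG by (auto simp: multigraph_iso_def)
  let ?S = "\<lambda>F. {\<phi> \<in> verts F \<rightarrow>\<^sub>E {..<dim_row B}. \<forall>u v. {u, v} \<in># edges F \<longrightarrow> B $$ (\<phi> u, \<phi> v) = 1}"
  let ?g = "inv_into (verts F) f"
  have f_in: "f u \<in> verts G" and g_f: "?g (f u) = u" if "u \<in> verts F" for u
    using that f by (auto simp: bij_betw_def)
  have g_in: "?g w \<in> verts F" and f_g: "f (?g w) = w" if "w \<in> verts G" for w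
    using that f by (auto simp: bij_betw_def f_inv_into_f inv_into_into)
  have edge_f: "{f u, f v} \<in># edges G" if "{u, v} \<in># edges F" for u v
  proof -
    have "f ` {u, v} \<in># edges G"
      unfolding E set_image_mset using that by (rule imageI)
    then show ?thesis by simp
  qed
  have edge_g: "{?g u, ?g v} \<in># edges F" if uv: "{u, v} \<in># edges G" for u v
  proof -
    obtain e where e: "e \<in># edges F" "{u, v} = f ` e"
      using uv by (auto simp: E)
    then have "{?g u, ?g v} = ?g ` f ` e"
      by (metis image_empty image_insert)
    also have "\<dots> = e"
      using f e(1) edges_subset by (metis bij_betw_imp_inj_on inv_into_image_cancel)
    finally show ?thesis
      using e(1) by simp
  qed
  have "bij_betw (\<lambda>\<phi>. \<lambda>w\<in>verts G. \<phi> (?g w)) (?S F) (?S G)"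
  proof (rule bij_betw_byWitness[where f' = "\<lambda>\<psi>. \<lambda>u\<in>verts F. \<psi> (f u)"])
    show "\<forall>\<phi>\<in>?S F. (\<lambda>u\<in>verts F. (\<lambda>w\<in>verts G. \<phi> (?g w)) (f u)) = \<phi>"
      by (auto simp: fun_eq_iff f_in g_f PiE_def extensional_def)
    show "\<forall>\<psi>\<in>?S G. (\<lambda>w\<in>verts G. (\<lambda>u\<in>verts F. \<psi> (f u)) (?g w)) = \<psi>"
      by (auto simp: fun_eq_iff g_in f_g PiE_def extensional_def)
    show "(\<lambda>\<phi>. \<lambda>w\<in>verts G. \<phi> (?g w)) ` ?S F \<subseteq> ?S G"
    proof clarify
      fix \<phi> assume \<phi>: "\<phi> \<in> verts F \<rightarrow>\<^sub>E {..<dim_row B}"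
        "\<forall>u v. {u, v} \<in># edges F \<longrightarrow> B $$ (\<phi> u, \<phi> v) = 1"
      have "(\<lambda>w\<in>verts G. \<phi> (?g w)) \<in> verts G \<rightarrow>\<^sub>E {..<dim_row B}"
        using \<phi>(1) g_in by (intro restrict_PiE_iff[THEN iffD2] ballI) blast
      moreover have "B $$ ((\<lambda>w\<in>verts G. \<phi> (?g w)) u, (\<lambda>w\<in>verts G. \<phi> (?g w)) v) = 1" if uv: "{u, v} \<in># edges G" for u v
        using edges_subset[OF uv] \<phi>(2)[rule_format, OF edge_g[OF uv]] by simp
      ultimately show "(\<lambda>w\<in>verts G. \<phi> (?g w)) \<in> verts G \<rightarrow>\<^sub>E {..<dim_row B} \<and>
          (\<forall>u v. {u, v} \<in># edges G \<longrightarrow> B $$ ((\<lambda>w\<in>verts G. \<phi> (?g w)) u, (\<lambda>w\<in>verts G. \<phi> (?g w)) v) = 1)"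
        by blast
    qed
    show "(\<lambda>\<psi>. \<lambda>u\<in>verts F. \<psi> (f u)) ` ?S G \<subseteq> ?S F"
    proof clarify
      fix \<psi> assume \<psi>: "\<psi> \<in> verts G \<rightarrow>\<^sub>E {..<dim_row B}"
        "\<forall>u v. {u, v} \<in># edges G \<longrightarrow> B $$ (\<psi> u, \<psi> v) = 1"
      have "(\<lambda>u\<in>verts F. \<psi> (f u)) \<in> verts F \<rightarrow>\<^sub>E {..<dim_row B}"
        using \<psi>(1) f_in by (intro restrict_PiE_iff[THEN iffD2] ballI) blast
      moreover have "B $$ ((\<lambda>u\<in>verts F. \<psi> (f u)) u, (\<lambda>u\<in>verts F. \<psi> (f u)) v) = 1" if uv: "{u, v} \<in># edges F" for u v
        using edges_subset[OF uv] \<psi>(2)[rule_format, OF edge_f[OF uv]] by simp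
      ultimately show "(\<lambda>u\<in>verts F. \<psi> (f u)) \<in> verts F \<rightarrow>\<^sub>E {..<dim_row B} \<and>
          (\<forall>u v. {u, v} \<in># edges F \<longrightarrow> B $$ ((\<lambda>u\<in>verts F. \<psi> (f u)) u, (\<lambda>u\<in>verts F. \<psi> (f u)) v) = 1)"
        by blast
    qed
  qed
  then show ?thesis
    using bij_betw_same_card[OF f] by (simp add: hom_prob_def bij_betw_same_card)
qed

end

theory Submission
  imports Defs
begin

text \<open>
  A vector chosen uniformly from the cube \<open>[0,1]\<^sup>V\<close> lies in a uniformly distributed box of
  steps, that is, it induces a uniformly distributed map \<open>V \<rightarrow> [n]\<close>. On each box the integrand of
  the density of a Hadamard graphon is constant, equal to 1 if every edge is mapped to an entry 1
  and to 0 otherwise. Hence the density of every multigraph is the fraction counted by \<open>P(B,F)\<close>,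
  and the two annihilating conditions coincide.
\<close>

lemma equal_step_subset:
  assumes "i < n"
  shows "equal_step n i \<subseteq> {0..1}"
proof
  fix x assume x: "x \<in> equal_step n i"
  have "0 \<le> real i / real n" "real (Suc i) / real n \<le> 1"
    using assms by simp_all
  \<comment> \<open>The first disjunct covers the last step, which is closed at 1; every other step
    is half-open.\<close>
  moreover have "real i / real n \<le> x" "x \<le> 1 \<or> x < real (Suc i) / real n"
    using x by (auto simp: equal_step_def split: if_splits)
  ultimately show "x \<in> {0..1}"
    unfolding atLeastAtMost_iff by linarith
qed

lemma sets_equal_step: "i < n \<Longrightarrow> equal_step n i \<in> sets unit_interval"
  using equal_step_subset[of i n]
  by (auto simp: sets_restrict_space_iff) (simp add: equal_step_def)

lemma measure_equal_step:
  assumes "i < n"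
  shows "measure unit_interval (equal_step n i) = 1 / real n"
proof -
  \<comment> \<open>For the last step the length appears as \<open>1 - i / n\<close>, which this
    turns into \<open>1 / n\<close>.\<close>
  have "real n - real i = 1" if "Suc i = n"
    using that by auto
  then have "measure lborel (equal_step n i) = 1 / real n"
    using assms by (auto simp: equal_step_def divide_simps)
  then show ?thesis
    using equal_step_subset[OF assms] by (simp add: measure_restrict_space)
qed

text \<open>The \<open>n ^ card (verts F)\<close> boxes \<open>A \<phi>\<close> partition the cube
  into sets of equal measure. Both sides read an edge in the order \<open>Min e\<close>,
  \<open>Max e\<close>, so \<open>a\<close> may be any function of two indices.\<close>

lemma hom_density_equal_step:
  assumes n: "0 < n"
    and W: "\<And>i j x y. i < n \<Longrightarrow> j < n \<Longrightarrow> x \<in> equal_step n i \<Longrightarrow> y \<in> equal_step n j \<Longrightarrow> W x y = a i j"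
  shows "hom_density F W =
    1 / real n ^ card (verts F) *
      (\<Sum>\<phi>\<in>verts F \<rightarrow>\<^sub>E {..<n}. \<Prod>e\<in>#edges F. a (\<phi> (Min e)) (\<phi> (Max e)))"
proof -
  \<comment> \<open>This supplies \<open>prob_times\<close>: the measure of a box is the product of
    the measures of its sides.\<close>
  interpret finite_product_prob_space "\<lambda>_. unit_interval" "verts F"
    by (simp add: finite_product_prob_space_def finite_product_sigma_finite_def
        finite_product_sigma_finite_axioms_def product_prob_spaceI[OF prob_space_unit_interval]
        product_prob_space.axioms(1))
  let ?M = "\<Pi>\<^sub>M i\<in>verts F. unit_interval"
  let ?\<Phi> = "verts F \<rightarrow>\<^sub>E {..<n}"
  let ?a = "\<lambda>\<phi>. \<Prod>e\<in>#edges F. a (\<phi> (Min e)) (\<phi> (Max e))"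
  define A where "A = (\<lambda>\<phi>. \<Pi>\<^sub>E v\<in>verts F. equal_step n (\<phi> v))"
  have fin: "finite ?\<Phi>"
    by (simp add: finite_PiE)
  have A: "A \<phi> \<in> sets ?M" "measure ?M (A \<phi>) = 1 / real n ^ card (verts F)" if "\<phi> \<in> ?\<Phi>" for \<phi>
  proof -
    have \<phi>: "\<phi> v < n" if "v \<in> verts F" for v
      using that \<open>\<phi> \<in> ?\<Phi>\<close> by blast
    then show "A \<phi> \<in> sets ?M"
      unfolding A_def by (intro sets_PiM_I_finite sets_equal_step) auto
    have "measure ?M (A \<phi>) = (\<Prod>v\<in>verts F. measure unit_interval (equal_step n (\<phi> v)))"
      unfolding A_def using \<phi> by (intro prob_times sets_equal_step)
    also have "\<dots> = 1 / real n ^ card (verts F)"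
      using \<phi> by (simp add: measure_equal_step power_one_over)
    finally show "measure ?M (A \<phi>) = 1 / real n ^ card (verts F)" .
  qed
  \<comment> \<open>The integrand is a simple function: each point lies in exactly one box, so a
    single summand survives.\<close>
  have "(\<Prod>e\<in>#edges F. W (x (Min e)) (x (Max e))) = (\<Sum>\<phi>\<in>?\<Phi>. ?a \<phi> * indicator (A \<phi>) x)"
    if x: "x \<in> space ?M" for x
  proof -
    have "\<exists>i<n. x v \<in> equal_step n i" if "v \<in> verts F" for v
      using equal_step_cover[OF n space_unit_PiM[OF x that]] by blast
    then obtain p where p: "\<And>v. v \<in> verts F \<Longrightarrow> p v < n \<and> x v \<in> equal_step n (p v)"
      by metis
    \<comment> \<open>Restriction makes the chosen indices an element of the extensional function
      space indexing the sum.\<close>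
    define \<psi> where "\<psi> = restrict p (verts F)"
    have \<psi>: "\<psi> \<in> ?\<Phi>"
      using p by (auto simp: \<psi>_def)
    have ext: "x \<in> extensional (verts F)"
      using x by (auto simp: space_PiM PiE_def)
    have ind: "indicator (A \<phi>) x = (if \<phi> = \<psi> then 1 else 0 :: real)" if \<phi>: "\<phi> \<in> ?\<Phi>" for \<phi>
    proof -
      have "\<phi> = \<psi>" if "x \<in> A \<phi>"
      proof (rule PiE_ext[OF \<phi> \<psi>])
        fix v assume v: "v \<in> verts F"
        then show "\<phi> v = \<psi> v"
          using equal_step_disjoint[of "x v" n "\<phi> v" "p v"] p[OF v] \<phi> \<open>x \<in> A \<phi>\<close>
          by (auto simp: A_def \<psi>_def)
      qed
      moreover have "x \<in> A \<psi>"
        using p ext by (auto simp: A_def \<psi>_def PiE_def)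
      ultimately have "x \<in> A \<phi> \<longleftrightarrow> \<phi> = \<psi>"
        by blast
      then show ?thesis
        by (simp add: indicator_def)
    qed
    have "(\<Prod>e\<in>#edges F. W (x (Min e)) (x (Max e))) = ?a \<psi>"
    proof (rule arg_cong[of _ _ prod_mset], rule image_mset_cong)
      fix e assume "e \<in># edges F"
      then have "Min e \<in> verts F" "Max e \<in> verts F"
        using edge_ends by auto
      then show "W (x (Min e)) (x (Max e)) = a (\<psi> (Min e)) (\<psi> (Max e))"
        using W p by (simp add: \<psi>_def)
    qed
    also have "\<dots> = (\<Sum>\<phi>\<in>?\<Phi>. if \<phi> = \<psi> then ?a \<phi> else 0)"
      using \<psi> fin by simp
    also have "\<dots> = (\<Sum>\<phi>\<in>?\<Phi>. ?a \<phi> * indicator (A \<phi>) x)"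
      by (intro sum.cong) (auto simp: ind)
    finally show ?thesis .
  qed
  then have "hom_density F W = (\<integral>x. (\<Sum>\<phi>\<in>?\<Phi>. ?a \<phi> * indicator (A \<phi>) x) \<partial>?M)"
    unfolding hom_density_def by (intro Bochner_Integration.integral_cong) auto
  also have "\<dots> = (\<Sum>\<phi>\<in>?\<Phi>. ?a \<phi> * measure ?M (A \<phi>))"
    using A(1) by (subst Bochner_Integration.integral_sum)
      (auto simp: less_top[symmetric] intro!: sum.cong)
  also have "\<dots> = 1 / real n ^ card (verts F) * (\<Sum>\<phi>\<in>?\<Phi>. ?a \<phi>)"
    using A(2) by (simp add: sum_distrib_left mult.commute)
  finally show ?thesis .
qed

text \<open>The map sending \<open>t\<close> to \<open>(t + 1) / 2\<close> takes the entries 1 and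
  -1 to 1 and 0. Each product over edges is therefore the indicator of an admissible map, and
  multiplicities have no effect on powers of 0 and 1.\<close>

lemma hom_density_hadamard_graphon:
  assumes n: "0 < n" and B: "hadamard_mat n B" "transpose_mat B = B"
  shows "hom_density F (hadamard_graphon B) = hom_prob B F"
proof -
  have dim: "dim_row B = n" "dim_col B = n"
    and entry: "\<And>i j. i < n \<Longrightarrow> j < n \<Longrightarrow> B $$ (i, j) \<in> {1, - 1}"
    using B by (auto simp: hadamard_mat_def)
  have sym: "B $$ (i, j) = B $$ (j, i)" if "i < n" "j < n" for i j
    using that B(2) dim by (metis index_transpose_mat(1))
  let ?\<Phi> = "verts F \<rightarrow>\<^sub>E {..<n}"
  let ?good = "\<lambda>\<phi>. \<forall>u v. {u, v} \<in># edges F \<longrightarrow> B $$ (\<phi> u, \<phi> v) = 1"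
  have "(\<Prod>e\<in>#edges F. (B $$ (\<phi> (Min e), \<phi> (Max e)) + 1) / 2) = (if ?good \<phi> then 1 else 0)"
    if \<phi>: "\<phi> \<in> ?\<Phi>" for \<phi>
  proof -
    have in_n: "\<phi> v < n" if "v \<in> verts F" for v
      using that \<phi> by blast
    \<comment> \<open>\<open>?good\<close> tests both orders of the end points, the product only
      one; symmetry of \<open>B\<close> bridges the two.\<close>
    have good: "?good \<phi> \<longleftrightarrow> (\<forall>e\<in>#edges F. B $$ (\<phi> (Min e), \<phi> (Max e)) = 1)"
    proof
      show "\<forall>e\<in>#edges F. B $$ (\<phi> (Min e), \<phi> (Max e)) = 1" if "?good \<phi>"
        using that edge_ends(1) by metis
      show "?good \<phi>" if *: "\<forall>e\<in>#edges F. B $$ (\<phi> (Min e), \<phi> (Max e)) = 1"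
      proof (intro allI impI)
        fix u v assume uv: "{u, v} \<in># edges F"
        then have "\<phi> u < n" "\<phi> v < n"
          using edges_subset in_n by auto
        then show "B $$ (\<phi> u, \<phi> v) = 1"
          using *[rule_format, OF uv] sym by (auto simp: min_def max_def split: if_splits)
      qed
    qed
    show ?thesis
    proof (cases "?good \<phi>")
      case True
      then have "image_mset (\<lambda>e. (B $$ (\<phi> (Min e), \<phi> (Max e)) + 1) / 2) (edges F)
          = image_mset (\<lambda>_. 1) (edges F)"
        unfolding good by (intro image_mset_cong) simp
      then show ?thesis
        using True by (simp only:) (simp add: image_mset_const_eq)
    next
      case False
      then obtain e where e: "e \<in># edges F" "B $$ (\<phi> (Min e), \<phi> (Max e)) \<noteq> 1"
        unfolding good by blast
      \<comment> \<open>An entry other than 1 is -1, so this one factor annihilates the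
        product.\<close>
      then have "(B $$ (\<phi> (Min e), \<phi> (Max e)) + 1) / 2 = 0"
        using entry[of "\<phi> (Min e)" "\<phi> (Max e)"] in_n edge_ends(2,3)[OF e(1)] by auto
      then show ?thesis
        using False e(1) by (simp only: if_False) (auto intro: image_eqI[of 0 _ e])
    qed
  qed
  then have "(\<Sum>\<phi>\<in>?\<Phi>. \<Prod>e\<in>#edges F. (B $$ (\<phi> (Min e), \<phi> (Max e)) + 1) / 2) =
      (\<Sum>\<phi>\<in>?\<Phi>. if ?good \<phi> then 1 else 0)"
    by (intro sum.cong) auto
  also have "\<dots> = real (card {\<phi> \<in> ?\<Phi>. ?good \<phi>})"
    by (simp add: sum.If_cases finite_PiE Int_def)
  finally have count: "(\<Sum>\<phi>\<in>?\<Phi>. \<Prod>e\<in>#edges F. (B $$ (\<phi> (Min e), \<phi> (Max e)) + 1) / 2) =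
      real (card {\<phi> \<in> ?\<Phi>. ?good \<phi>})" .
  have "hadamard_graphon B x y = (B $$ (i, j) + 1) / 2"
    if "i < n" "j < n" "x \<in> equal_step n i" "y \<in> equal_step n j" for i j x y
    using that step_kernel_eq[of i B j x y] by (simp add: hadamard_graphon_def dim)
  from hom_density_equal_step[OF n this, where F = F] count show ?thesis
    by (simp add: hom_prob_def dim)
qed

theorem theorem6p9:
  fixes n :: nat and B :: "real mat"
  assumes "n \<ge> 1"
    and "hadamard_mat n B"
    and "transpose_mat B = B"
  shows "annihilator {hadamard_graphon B} = {g. quantum_prob B g = 0}"
  \<comment> \<open>Both conditions are linear extensions of parameters that agree on every
    multigraph, hence on all class representatives.\<close>
  using assms by (simp add: annihilator_def quantum_density_def quantum_prob_def
      hom_density_hadamard_graphon[of n])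

end
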